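(* Let $\Lambda\subset\mathbb{R}$ be open, let $f:\mathbb{R}^n\times\Lambda\to\mathbb{R}^n$ be such that $f_\lambda:=f(\cdot,\lambda)$ is a homeomorphism of $\mathbb{R}^n$ for each $\lambda\in\Lambda$, with $f$ uniformly continuous in $\lambda$ on bounded sets, and assume that for each $\lambda\in\Lambda$ the map $f_\lambda$ has a compact global attractor $A^\lambda\subset\mathbb{R}^n$. Let $Q\subset\mathbb{R}^n$ be a compact set with $A^\lambda\subset Q$ for all $\lambda\in\Lambda$. Let $\lambda_0\in\Lambda$ and let $\mathcal{Q}(\lambda_0)=\{Q_0^{\lambda_0},\ldots,Q_m^{\lambda_0}\}$ be the family of sets generated by the subdivision method for $g=f_{\lambda_0}$ started at $Q$, such that $A_Q^{\lambda_0}=A^{\lambda_0}\subset Q_k^{\lambda_0}$ for all $k=0,\ldots,m$, where $A_Q^{\lambda_0}=\bigcap_{j\ge 0}f_{\lambda_0}^j(Q)$ is the global attractor of $f_{\lambda_0}$ relative to $Q$. Suppose that there is $\varepsilon>0$ such that $U_\varepsilon(A^{\lambda_0})\subset Q_k^{\lambda_0}$ for all $k=0,\ldots,m$, and that $A^\lambda$ is upper semi-continuous at $\lambda_0$. Then for every $k=0,\ldots,m$ there exists $\delta=\delta(k)>0$ such that $A^\lambda\subset Q_k^{\lambda_0}$ for all $\lambda\in U_\delta(\lambda_0)$. In particular, $A^\lambda$ can be approximated (by the subdivision method) by using the initial compact set $Q_k^{\lambda_0}$.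
   Context: Compact global attractor of a homeomorphism $g:\mathbb{R}^n\to\mathbb{R}^n$: a compact set $A\subset\mathbb{R}^n$ that attracts any bounded set $B\subset\mathbb{R}^n$. Distance: $\mathrm{dist}(B,C)=\sup_{x\in B}\inf_{y\in C}\|x-y\|$ for subsets $B,C$ of $\mathbb{R}^n$. $U_\varepsilon(A)\subset\mathbb{R}^n$ denotes the $\varepsilon$-neighborhood of $A$, and $U_\delta(\lambda_0)\subset\Lambda$ denotes the $\delta$-neighborhood of $\lambda_0$. Upper semi-continuity at $\lambda_0$: $\lim_{\lambda\to\lambda_0}\mathrm{dist}(A^\lambda,A^{\lambda_0})=0$. Subdivision method for a homeomorphism $g:\mathbb{R}^n\to\mathbb{R}^n$ started at a compact set $Q$, with $0<\theta<1$: start with a finite collection $\mathcal{B}_0$ of compact subsets of $\mathbb{R}^n$ with $\bigcup_{B\in\mathcal{B}_0}B=Q$ (e.g. $\mathcal{B}_0=\{Q\}$). For a finite collection $\mathcal{B}$ put $\mathrm{diam}(\mathcal{B})=\max_{B\in\mathcal{B}}\mathrm{diam}(B)$. For $k=1,2,\ldots$ obtain $\mathcal{B}_k$ from $\mathcal{B}_{k-1}$ in two steps. (1) Subdivision: construct a new finite collection $\widehat{\mathcal{B}}_k$ of compact sets with $\bigcup_{B\in\widehat{\mathcal{B}}_k}B=\bigcup_{B\in\mathcal{B}_{k-1}}B$ and $\mathrm{diam}(\widehat{\mathcal{B}}_k)=\theta\,\mathrm{diam}(\mathcal{B}_{k-1})$. (2) Selection: $\mathcal{B}_k=\{B\in\widehat{\mathcal{B}}_k:\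 \exists\,\widehat B\in\widehat{\mathcal{B}}_k\text{ such that } g^{-1}(B)\cap\widehat B\neq\emptyset\}$. The set obtained after $k$ steps is $Q_k=\bigcup_{B\in\mathcal{B}_k}B$ (so $Q_0=Q$); for $g=f_{\lambda_0}$ it is written $Q_k^{\lambda_0}$.
   Formalization: In the closing claim, dist(Q_j, A^λ)→0 holds for every run started at Q_k; that A^λ stays inside all sets of the run is asserted only if f_λ(A^λ)=A^λ, since a compact attracting set that is not invariant (e.g. [-|λ|,|λ|] for x/2) is not approximated. *)

theory Defs
  imports "HOL-Analysis.Analysis"
begin

(* The values lie in ennreal so that the supremum and the infimum are total:
   semidist {} C = 0, and semidist B {} = \<infinity> for nonempty B. *)
definition semidist :: "'a::metric_space set \<Rightarrow> 'a set \<Rightarrow> ennreal" where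
  "semidist B C = (SUP x\<in>B. INF y\<in>C. ennreal (dist x y))"

definition is_homeo :: "('a::topological_space \<Rightarrow> 'a) \<Rightarrow> bool" where
  "is_homeo g \<longleftrightarrow> (\<exists>h. homeomorphism UNIV UNIV g h)"

(* Invariance is not part of the definition, so a compact global attractor need not be unique. *)
definition global_attractor :: "('a::metric_space \<Rightarrow> 'a) \<Rightarrow> 'a set \<Rightarrow> bool" where
  "global_attractor g A \<longleftrightarrow>
     compact A \<and> (\<forall>B. bounded B \<longrightarrow> (\<lambda>j. semidist ((g ^^ j) ` B) A) \<longlonglongrightarrow> 0)"

definition relative_attractor :: "('a \<Rightarrow> 'a) \<Rightarrow> 'a set \<Rightarrow> 'a set" where
  "relative_attractor g Q = (\<Inter>j. (g ^^ j) ` Q)"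

definition nbhd :: "real \<Rightarrow> 'a::metric_space set \<Rightarrow> 'a set" where
  "nbhd e A = (\<Union>a\<in>A. ball a e)"

(* Continuity of the parameter dependence at each parameter, uniform in x on bounded sets.
   Asking in addition for uniformity in the parameter would be a stronger hypothesis. *)
definition param_cont_unif_on_bounded ::
    "('a::metric_space \<Rightarrow> real \<Rightarrow> 'a) \<Rightarrow> real set \<Rightarrow> bool" where
  "param_cont_unif_on_bounded f \<Lambda> \<longleftrightarrow>
     (\<forall>B. bounded B \<longrightarrow>
        (\<forall>\<mu>\<in>\<Lambda>. uniform_limit B (\<lambda>l x. f x l) (\<lambda>x. f x \<mu>) (at \<mu> within \<Lambda>)))"

definition upper_semicontinuous_at ::
    "(real \<Rightarrow> 'a::metric_space set) \<Rightarrow> real set \<Rightarrow> real \<Rightarrow> bool" where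
  "upper_semicontinuous_at A \<Lambda> l0 \<longleftrightarrow>
     ((\<lambda>l. semidist (A l) (A l0)) \<longlongrightarrow> 0) (at l0 within \<Lambda>)"

definition compact_collection :: "'a::metric_space set set \<Rightarrow> bool" where
  "compact_collection \<B> \<longleftrightarrow> finite \<B> \<and> (\<forall>B\<in>\<B>. compact B)"

(* The inserted 0 only matters for the empty collection, since diameters are nonnegative. *)
definition collection_diam :: "'a::metric_space set set \<Rightarrow> real" where
  "collection_diam \<B> = Max (insert 0 (diameter ` \<B>))"

definition select_boxes :: "('a \<Rightarrow> 'a) \<Rightarrow> 'a set set \<Rightarrow> 'a set set" where
  "select_boxes g \<B> = {B \<in> \<B>. \<exists>B'\<in>\<B>. g -` B \<inter> B' \<noteq> {}}"

definition subdivision_step ::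
    "('a::metric_space \<Rightarrow> 'a) \<Rightarrow> real \<Rightarrow> 'a set set \<Rightarrow> 'a set set \<Rightarrow> bool" where
  "subdivision_step g \<theta> \<B> \<B>' \<longleftrightarrow>
     (\<exists>\<C>. compact_collection \<C> \<and> \<Union>\<C> = \<Union>\<B> \<and>
          collection_diam \<C> = \<theta> * collection_diam \<B> \<and>
          \<B>' = select_boxes g \<C>)"

(* The first m steps of the method; only \<B> 0, ..., \<B> m are constrained.  The step is a relation
   because the refinement is not unique.  The covered sets are Q_k = \<Union>(\<B> k). *)
definition subdivision_run ::
    "('a::metric_space \<Rightarrow> 'a) \<Rightarrow> real \<Rightarrow> 'a set \<Rightarrow> nat \<Rightarrow> (nat \<Rightarrow> 'a set set) \<Rightarrow> bool" where
  "subdivision_run g \<theta> Q m \<B> \<longleftrightarrow>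
     compact_collection (\<B> 0) \<and> \<Union>(\<B> 0) = Q \<and>
     (\<forall>k<m. subdivision_step g \<theta> (\<B> k) (\<B> (Suc k)))"

(* Every run of unbounded length started at Q converges to A: the covered sets accumulate only at A,
   and they all contain A if A is invariant, so that then the Hausdorff distance tends to 0.
   The enclosure fails without invariance: for g x = x / 2 every closed ball about 0 is a compact
   global attractor in the above sense, whereas the covered sets shrink to {0}. *)
definition subdivision_approximates ::
    "('a::metric_space \<Rightarrow> 'a) \<Rightarrow> 'a set \<Rightarrow> 'a set \<Rightarrow> bool" where
  "subdivision_approximates g Q A \<longleftrightarrow>
     (\<forall>\<theta> \<B>. 0 < \<theta> \<longrightarrow> \<theta> < 1 \<longrightarrow> (\<forall>m. subdivision_run g \<theta> Q m \<B>) \<longrightarrow>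
        (\<lambda>j. semidist (\<Union>(\<B> j)) A) \<longlonglongrightarrow> 0 \<and>
        (g ` A = A \<longrightarrow> (\<forall>j. A \<subseteq> \<Union>(\<B> j))))"

end

theory Submission
  imports Defs
begin

text \<open>
  Since the \<open>\<epsilon>\<close>-neighbourhood of \<open>A l0\<close> is contained in \<open>Q\<^sub>k\<close>, upper semicontinuity puts \<open>A l\<close> into \<open>Q\<^sub>k\<close>
  for \<open>l\<close> near \<open>l0\<close>.  For the convergence of the method started at \<open>Q\<^sub>k\<close>, let \<open>K\<close> be the intersection
  of the nested covered sets.  The selection rule gives every point of \<open>K\<close> approximate preimages in
  each covered set, with an error bounded by the box diameters; by compactness \<open>K \<subseteq> g ` K\<close>.  Hence
  \<open>K \<subseteq> (g ^^ j) ` K\<close> for all \<open>j\<close>, so \<open>K\<close> lies in any compact set attracting it, and the covered sets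
  converge to \<open>K\<close>.
\<close>

section \<open>Semidistance and neighbourhoods\<close>

lemma subset_nbhd_of_semidist_less:
  assumes "semidist B C < ennreal e"
  shows "B \<subseteq> nbhd e C"
proof
  fix x assume "x \<in> B"
  then have "(INF y\<in>C. ennreal (dist x y)) \<le> semidist B C"
    unfolding semidist_def by (rule SUP_upper)
  then have "(INF y\<in>C. ennreal (dist x y)) < ennreal e"
    using assms by (rule le_less_trans)
  then obtain y where "y \<in> C" "ennreal (dist x y) < ennreal e"
    by (auto simp: INF_less_iff)
  then have "dist y x < e"
    by (simp add: ennreal_less_iff dist_commute)
  with \<open>y \<in> C\<close> show "x \<in> nbhd e C"
    by (auto simp: nbhd_def)
qed

text \<open>The bound cannot be strict: a supremum of values below \<open>e\<close> may equal
  \<open>e\<close>.\<close>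

lemma semidist_le_of_subset_nbhd:
  assumes "B \<subseteq> nbhd e C"
  shows "semidist B C \<le> ennreal e"
  unfolding semidist_def
proof (rule SUP_least)
  fix x assume "x \<in> B"
  then obtain y where "y \<in> C" "dist y x < e"
    using assms by (auto simp: nbhd_def)
  then show "(INF y\<in>C. ennreal (dist x y)) \<le> ennreal e"
    by (intro INF_lower2[of y]) (auto simp: dist_commute intro!: ennreal_leI)
qed

text \<open>The filter is arbitrary so that one equivalence serves both the limits over iterates or
  subdivision steps and the limit over parameters.\<close>

lemma semidist_tendsto_0_iff:
  "((\<lambda>i. semidist (B i) C) \<longlongrightarrow> 0) F \<longleftrightarrow> (\<forall>e>0. \<forall>\<^sub>F i in F. B i \<subseteq> nbhd e C)"
proof
  assume lim: "((\<lambda>i. semidist (B i) C) \<longlongrightarrow> 0) F"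
  show "\<forall>e>0. \<forall>\<^sub>F i in F. B i \<subseteq> nbhd e C"
  proof (intro allI impI)
    fix e :: real assume "e > 0"
    then have "\<forall>\<^sub>F i in F. semidist (B i) C < ennreal e"
      by (intro order_tendstoD(2)[OF lim]) simp
    then show "\<forall>\<^sub>F i in F. B i \<subseteq> nbhd e C"
      by (rule eventually_mono) (rule subset_nbhd_of_semidist_less)
  qed
next
  assume sub: "\<forall>e>0. \<forall>\<^sub>F i in F. B i \<subseteq> nbhd e C"
  show "((\<lambda>i. semidist (B i) C) \<longlongrightarrow> 0) F"
  proof (rule order_tendstoI)
    fix a :: ennreal assume "0 < a"
    \<comment> \<open>An intermediate \<open>c\<close> is finite even if \<open>a\<close> is
      infinite, so it provides a real radius; it also turns the non-strict bound of
      \<open>semidist_le_of_subset_nbhd\<close> into a strict one.\<close>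
    then obtain c where c: "0 < c" "c < a"
      using dense by blast
    then obtain r where r: "c = ennreal r" "0 \<le> r"
      by (cases c) auto
    with c have "r > 0" by auto
    with sub have "\<forall>\<^sub>F i in F. B i \<subseteq> nbhd r C" by blast
    then show "\<forall>\<^sub>F i in F. semidist (B i) C < a"
      using semidist_le_of_subset_nbhd c r by (auto elim!: eventually_mono intro: le_less_trans)
  qed simp
qed

lemma open_nbhd: "open (nbhd e A)"
  by (auto simp: nbhd_def)

lemma subset_nbhd: "e > 0 \<Longrightarrow> A \<subseteq> nbhd e A"
  by (force simp: nbhd_def)

lemma closed_nbhd_Inter:
  assumes "closed A" "\<And>e. e > 0 \<Longrightarrow> x \<in> nbhd e A"
  shows "x \<in> A"
proof -
  have "x \<in> closure A"
    using assms(2) by (force simp: closure_approachable nbhd_def)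
  then show ?thesis using assms(1) by simp
qed

section \<open>Backward invariant sets and nested compact sets\<close>

lemma backward_invariant_funpow:
  assumes "K \<subseteq> g ` K"
  shows "K \<subseteq> (g ^^ j) ` K"
proof (induction j)
  case (Suc j)
  have "(g ^^ j) ` K \<subseteq> (g ^^ j) ` (g ` K)"
    using assms by (rule image_mono)
  with Suc show ?case by (auto simp: image_comp funpow_Suc_right simp del: funpow.simps)
qed simp

text \<open>Attraction only controls the iterated images of \<open>K\<close>, but each of them
  contains \<open>K\<close>. Thus \<open>K\<close> lies in every neighbourhood of \<open>A\<close>,
  and \<open>A\<close> is closed.\<close>

lemma backward_invariant_subset_attractor:
  assumes "global_attractor g A" "bounded K" "K \<subseteq> g ` K"
  shows "K \<subseteq> A"
proof
  fix x assume "x \<in> K"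
  have "closed A"
    using assms(1) by (auto simp: global_attractor_def compact_imp_closed)
  then show "x \<in> A"
  proof (rule closed_nbhd_Inter)
    fix e :: real assume "e > 0"
    then have "\<forall>\<^sub>F j in sequentially. (g ^^ j) ` K \<subseteq> nbhd e A"
      using assms(1,2) by (auto simp: global_attractor_def semidist_tendsto_0_iff)
    then obtain j where "(g ^^ j) ` K \<subseteq> nbhd e A"
      by (auto simp: eventually_sequentially)
    then show "x \<in> nbhd e A"
      using backward_invariant_funpow[OF assms(3)] \<open>x \<in> K\<close> by blast
  qed
qed

text \<open>The remainders \<open>K j - U\<close> are nested compact sets with empty intersection,
  so one of them is empty, and then so are all later ones.\<close>

lemma compact_nested_subset_open:
  fixes K :: "nat \<Rightarrow> 'a::heine_borel set"
  assumes "\<And>j. compact (K j)" "decseq K" "open U" "(\<Inter>j. K j) \<subseteq> U"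
  shows "\<forall>\<^sub>F j in sequentially. K j \<subseteq> U"
proof -
  have "\<exists>j. K j - U = {}"
  proof (rule ccontr)
    assume "\<not> ?thesis"
    then have "(\<Inter>j. K j - U) \<noteq> {}"
      using assms by (intro compact_nest) (auto simp: compact_diff dest: decseqD)
    with assms(4) show False by blast
  qed
  then obtain j where "K j \<subseteq> U" by blast
  then have "\<And>i. i \<ge> j \<Longrightarrow> K i \<subseteq> U"
    using assms(2) by (blast dest: decseqD)
  then show ?thesis by (auto simp: eventually_sequentially)
qed

section \<open>A single subdivision step\<close>

lemma collection_diam_nonneg: "finite \<B> \<Longrightarrow> 0 \<le> collection_diam \<B>"
  unfolding collection_diam_def by (intro Max_ge) auto

lemma diameter_le_collection_diam: "finite \<B> \<Longrightarrow> B \<in> \<B> \<Longrightarrow> diameter B \<le> collection_diam \<B>"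
  unfolding collection_diam_def by (intro Max_ge) auto

lemma collection_diam_mono: "finite \<C> \<Longrightarrow> \<B> \<subseteq> \<C> \<Longrightarrow> collection_diam \<B> \<le> collection_diam \<C>"
  unfolding collection_diam_def by (intro Max_mono) auto

lemma subdivision_stepE:
  assumes "subdivision_step g \<theta> \<B> \<B>'"
  obtains \<C> where "finite \<C>" "\<forall>B\<in>\<C>. compact B" "\<Union>\<C> = \<Union>\<B>"
    "collection_diam \<C> = \<theta> * collection_diam \<B>" "\<B>' = select_boxes g \<C>"
proof -
  obtain \<C> where "compact_collection \<C>" "\<Union>\<C> = \<Union>\<B>"
      "collection_diam \<C> = \<theta> * collection_diam \<B>" "\<B>' = select_boxes g \<C>"
    using assms unfolding subdivision_step_def by (elim exE conjE)
  then show ?thesis by (intro that[of \<C>]) (simp_all add: compact_collection_def)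
qed

lemma select_boxes_subset: "select_boxes g \<C> \<subseteq> \<C>"
  by (auto simp: select_boxes_def)

lemma subdivision_step_compact_collection:
  assumes "subdivision_step g \<theta> \<B> \<B>'"
  shows "compact_collection \<B>'"
  using assms by (elim subdivision_stepE) (simp add: compact_collection_def select_boxes_def)

lemma subdivision_step_Union_subset:
  assumes "subdivision_step g \<theta> \<B> \<B>'"
  shows "\<Union>\<B>' \<subseteq> \<Union>\<B>"
  using assms by (elim subdivision_stepE) (metis Union_mono select_boxes_subset)

text \<open>Only an inequality survives the selection, which may discard the largest boxes.\<close>

lemma subdivision_step_collection_diam:
  assumes "subdivision_step g \<theta> \<B> \<B>'"
  shows "collection_diam \<B>' \<le> \<theta> * collection_diam \<B>"
  using assms by (elim subdivision_stepE) (metis collection_diam_mono select_boxes_subset)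

text \<open>A box around \<open>x\<close> is kept only if \<open>g\<close> maps some
  \<open>y\<close> of the refined collection into it, and then \<open>x\<close> and
  \<open>g y\<close> share that box. Since \<open>y\<close> may lie in a discarded box, it is
  located only in the union before the step.\<close>

lemma subdivision_step_approx_preimage:
  assumes "subdivision_step g \<theta> \<B> \<B>'" "x \<in> \<Union>\<B>'"
  obtains y where "y \<in> \<Union>\<B>" "dist x (g y) \<le> \<theta> * collection_diam \<B>"
proof -
  obtain \<C> where \<C>: "finite \<C>" "\<forall>B\<in>\<C>. compact B" "\<Union>\<C> = \<Union>\<B>"
      "collection_diam \<C> = \<theta> * collection_diam \<B>" "\<B>' = select_boxes g \<C>"
    using assms(1) by (rule subdivision_stepE)
  then obtain B B' y where B: "B \<in> \<C>" "x \<in> B" "B' \<in> \<C>" "y \<in> B'" "g y \<in> B"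
    using assms(2) by (auto simp: select_boxes_def)
  have "dist x (g y) \<le> diameter B"
    using \<C>(2) B by (intro diameter_bounded_bound compact_imp_bounded) auto
  also have "\<dots> \<le> \<theta> * collection_diam \<B>"
    using diameter_le_collection_diam[OF \<C>(1)] B(1) \<C>(4) by simp
  finally show ?thesis using that[of y] B \<C>(3) by blast
qed

text \<open>Invariance gives \<open>x\<close> a preimage in \<open>A\<close>; the box holding this
  preimage is the witness by which a box around \<open>x\<close> is selected.\<close>

lemma subdivision_step_invariant_subset:
  assumes "subdivision_step g \<theta> \<B> \<B>'" "g ` A = A" "A \<subseteq> \<Union>\<B>"
  shows "A \<subseteq> \<Union>\<B>'"
proof
  fix x assume "x \<in> A"
  obtain \<C> where \<C>: "\<Union>\<C> = \<Union>\<B>" "\<B>' = select_boxes g \<C>"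
    using assms(1) by (rule subdivision_stepE)
  obtain y where y: "y \<in> A" "x = g y" using \<open>x \<in> A\<close> assms(2) by auto
  obtain B B' where "B \<in> \<C>" "x \<in> B" "B' \<in> \<C>" "y \<in> B'"
    using \<open>x \<in> A\<close> y(1) assms(3) \<C>(1) by blast
  then show "x \<in> \<Union>\<B>'" using y(2) \<C>(2) by (auto simp: select_boxes_def)
qed

section \<open>The limit set and convergence of the method\<close>

lemma subdivision_limit_backward_invariant:
  fixes g :: "'a::heine_borel \<Rightarrow> 'a"
  assumes cont: "continuous_on UNIV g" and \<theta>: "0 < \<theta>" "\<theta> < 1"
    and B0: "compact_collection (\<B> 0)"
    and step: "\<And>k. subdivision_step g \<theta> (\<B> k) (\<B> (Suc k))"
    and cpt: "\<And>k. compact (\<Union>(\<B> k))" and dec: "decseq (\<lambda>k. \<Union>(\<B> k))"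
  shows "(\<Inter>k. \<Union>(\<B> k)) \<subseteq> g ` (\<Inter>k. \<Union>(\<B> k))"
proof
  fix x assume x: "x \<in> (\<Inter>k. \<Union>(\<B> k))"
  define D where "D = collection_diam (\<B> 0)"
  define r where "r k = \<theta> ^ k * D" for k
  \<comment> \<open>Candidates at level \<open>k\<close> for a preimage of \<open>x\<close>. The
    radius has index \<open>Suc k\<close> because the step from level \<open>k\<close> to the next
    has error at most \<open>\<theta> * r k\<close>.\<close>
  define F where "F k = \<Union>(\<B> k) \<inter> g -` cball x (r (Suc k))" for k
  have D: "0 \<le> D"
    using B0 by (simp add: D_def compact_collection_def collection_diam_nonneg)
  have diam: "collection_diam (\<B> k) \<le> r k" for k
  proof (induction k)
    case (Suc k)
    have "collection_diam (\<B> (Suc k)) \<le> \<theta> * collection_diam (\<B> k)"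
      using step by (rule subdivision_step_collection_diam)
    also have "\<dots> \<le> \<theta> * r k" using Suc \<theta> by simp
    finally show ?case by (simp add: r_def)
  qed (simp add: r_def D_def)
  have r_dec: "r (Suc j) \<le> r (Suc i)" if "i \<le> j" for i j
    using that \<theta> D unfolding r_def by (intro mult_right_mono power_decreasing) auto
  \<comment> \<open>Approximate preimages at different levels are unrelated points; nested
    compactness produces one point that is a candidate at all levels at once.\<close>
  have "(\<Inter>k. F k) \<noteq> {}"
  proof (rule compact_nest)
    show "compact (F k)" for k
      unfolding F_def using cpt cont
      by (intro compact_Int_closed closed_vimage) auto
    show "F k \<noteq> {}" for k
    proof -
      have "x \<in> \<Union>(\<B> (Suc k))" using x by blast
      then obtain y where y: "y \<in> \<Union>(\<B> k)" "dist x (g y) \<le> \<theta> * collection_diam (\<B> k)"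
        using subdivision_step_approx_preimage[OF step] by blast
      note y(2)
      also have "\<theta> * collection_diam (\<B> k) \<le> \<theta> * r k"
        using diam \<theta> by simp
      finally have "y \<in> F k" using y(1) by (simp add: F_def r_def)
      then show ?thesis by blast
    qed
    show "F j \<subseteq> F i" if "i \<le> j" for i j
      unfolding F_def using decseqD[OF dec that] r_dec[OF that]
      by (intro Int_mono vimage_mono subset_cball)
  qed
  then obtain y where y: "\<And>k. y \<in> F k" by blast
  \<comment> \<open>The common candidate obeys every error bound, and these decay geometrically, so
    it is an exact preimage.\<close>
  have "(\<lambda>k. \<theta> ^ Suc k * D) \<longlonglongrightarrow> 0 * D"
    using \<theta> by (intro tendsto_mult tendsto_const LIMSEQ_Suc LIMSEQ_power_zero) simp
  then have "dist x (g y) \<le> 0 * D"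
    by (rule LIMSEQ_le_const) (use y in \<open>auto simp: F_def r_def\<close>)
  then have "x = g y" by simp
  moreover have "y \<in> (\<Inter>k. \<Union>(\<B> k))" using y by (auto simp: F_def)
  ultimately show "x \<in> g ` (\<Inter>k. \<Union>(\<B> k))" by blast
qed

lemma subdivision_approximates_global_attractor:
  fixes g :: "'a::heine_borel \<Rightarrow> 'a"
  assumes "continuous_on UNIV g" "global_attractor g A" "A \<subseteq> Q"
  shows "subdivision_approximates g Q A"
  unfolding subdivision_approximates_def
proof (intro allI impI conjI)
  fix \<theta> :: real and \<B> :: "nat \<Rightarrow> 'a set set"
  assume \<theta>: "0 < \<theta>" "\<theta> < 1" and run: "\<forall>m. subdivision_run g \<theta> Q m \<B>"
  have B0: "compact_collection (\<B> 0)" and Q: "\<Union>(\<B> 0) = Q"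
    using run by (auto simp: subdivision_run_def)
  \<comment> \<open>A run of length \<open>m\<close> constrains the steps with index below
    \<open>m\<close>, so step \<open>k\<close> is read off the run of length
    \<open>Suc k\<close>.\<close>
  have step: "subdivision_step g \<theta> (\<B> k) (\<B> (Suc k))" for k
    using run[rule_format, of "Suc k"] by (auto simp: subdivision_run_def)
  show "A \<subseteq> \<Union>(\<B> j)" if "g ` A = A" for j
    by (induction j) (use assms(3) Q step that subdivision_step_invariant_subset in blast)+
  have "compact_collection (\<B> k)" for k
    using B0 subdivision_step_compact_collection[OF step] by (cases k) auto
  then have cpt: "compact (\<Union>(\<B> k))" for k
    by (auto simp: compact_collection_def intro: compact_Union)
  have dec: "decseq (\<lambda>k. \<Union>(\<B> k))"
    using subdivision_step_Union_subset[OF step] by (intro decseq_SucI) simp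
  have "bounded (\<Inter>k. \<Union>(\<B> k))"
    using cpt[of 0] by (rule bounded_subset[OF compact_imp_bounded]) blast
  then have "(\<Inter>k. \<Union>(\<B> k)) \<subseteq> A"
    using subdivision_limit_backward_invariant[OF assms(1) \<theta> B0 step cpt dec]
    by (intro backward_invariant_subset_attractor[OF assms(2)])
  \<comment> \<open>The open set \<open>nbhd e A\<close> contains the limit set, hence all but
    finitely many of the nested compact covered sets.\<close>
  then have "\<forall>\<^sub>F j in sequentially. \<Union>(\<B> j) \<subseteq> nbhd e A" if "e > 0" for e
    using subset_nbhd[OF that] by (intro compact_nested_subset_open[OF cpt dec open_nbhd]) blast
  then show "(\<lambda>j. semidist (\<Union>(\<B> j)) A) \<longlonglongrightarrow> 0"
    by (simp add: semidist_tendsto_0_iff)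
qed

section \<open>Upper semicontinuity and nearby parameters\<close>

lemma upper_semicontinuous_at_subset_ball:
  assumes "open \<Lambda>" "l0 \<in> \<Lambda>" "upper_semicontinuous_at A \<Lambda> l0" "e > 0"
  obtains d where "d > 0" "ball l0 d \<subseteq> \<Lambda>" "\<And>l. l \<in> ball l0 d \<Longrightarrow> A l \<subseteq> nbhd e (A l0)"
proof -
  have "\<forall>\<^sub>F l in at l0 within \<Lambda>. A l \<subseteq> nbhd e (A l0)"
    using assms(3,4) by (simp add: upper_semicontinuous_at_def semidist_tendsto_0_iff)
  then obtain d1 where d1: "d1 > 0"
      "\<And>l. l \<in> \<Lambda> \<Longrightarrow> l \<noteq> l0 \<Longrightarrow> dist l l0 < d1 \<Longrightarrow> A l \<subseteq> nbhd e (A l0)"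
    by (auto simp: eventually_at)
  \<comment> \<open>The radius \<open>d1\<close> only controls parameters inside
    \<open>\<Lambda>\<close>; openness of \<open>\<Lambda>\<close> makes this a full ball.\<close>
  obtain d2 where d2: "d2 > 0" "ball l0 d2 \<subseteq> \<Lambda>"
    using assms(1,2) by (rule openE)
  show ?thesis
  proof (rule that[of "min d1 d2"])
    show "min d1 d2 > 0" using d1(1) d2(1) by simp
    show sub: "ball l0 (min d1 d2) \<subseteq> \<Lambda>" using d2(2) by auto
    show "A l \<subseteq> nbhd e (A l0)" if "l \<in> ball l0 (min d1 d2)" for l
    \<comment> \<open>The limit leaves out the centre, where positivity of \<open>e\<close>
      suffices.\<close>
    proof (cases "l = l0")
      case False
      moreover have "l \<in> \<Lambda>" using sub that by blast
      ultimately show ?thesis using that by (intro d1(2)) (auto simp: dist_commute)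
    qed (use subset_nbhd[OF assms(4)] in simp)
  qed
qed

theorem proposition2p6:
  fixes \<Lambda> :: "real set"
    and f :: "real ^ 'n \<Rightarrow> real \<Rightarrow> real ^ 'n"
    and A :: "real \<Rightarrow> (real ^ 'n) set"
    and Q :: "(real ^ 'n) set"
    and l0 \<theta> \<epsilon> :: real
    and m :: nat
    and \<B> :: "nat \<Rightarrow> (real ^ 'n) set set"
  assumes "open \<Lambda>"
    and "\<And>l. l \<in> \<Lambda> \<Longrightarrow> is_homeo (\<lambda>x. f x l)"
    and "param_cont_unif_on_bounded f \<Lambda>"
    and "\<And>l. l \<in> \<Lambda> \<Longrightarrow> global_attractor (\<lambda>x. f x l) (A l)"
    and "compact Q"
    and "\<And>l. l \<in> \<Lambda> \<Longrightarrow> A l \<subseteq> Q"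
    and "l0 \<in> \<Lambda>"
    and "0 < \<theta>" and "\<theta> < 1"
    and "subdivision_run (\<lambda>x. f x l0) \<theta> Q m \<B>"
    and "relative_attractor (\<lambda>x. f x l0) Q = A l0"
    and "\<And>k. k \<le> m \<Longrightarrow> A l0 \<subseteq> \<Union>(\<B> k)"
    and "\<epsilon> > 0"
    and "\<And>k. k \<le> m \<Longrightarrow> nbhd \<epsilon> (A l0) \<subseteq> \<Union>(\<B> k)"
    and "upper_semicontinuous_at A \<Lambda> l0"
  shows "\<forall>k\<le>m. \<exists>\<delta>>0. ball l0 \<delta> \<subseteq> \<Lambda> \<and>
           (\<forall>l\<in>ball l0 \<delta>.
              A l \<subseteq> \<Union>(\<B> k) \<and>
              subdivision_approximates (\<lambda>x. f x l) (\<Union>(\<B> k)) (A l))"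
proof (intro allI impI)
  fix k assume k: "k \<le> m"
  \<comment> \<open>The choice depends on \<open>\<epsilon>\<close> and not on \<open>k\<close>, so
    the same radius serves every level.\<close>
  obtain \<delta> where \<delta>: "\<delta> > 0" "ball l0 \<delta> \<subseteq> \<Lambda>"
      "\<And>l. l \<in> ball l0 \<delta> \<Longrightarrow> A l \<subseteq> nbhd \<epsilon> (A l0)"
    using upper_semicontinuous_at_subset_ball[OF assms(1,7,15,13)] by blast
  have "A l \<subseteq> \<Union>(\<B> k) \<and> subdivision_approximates (\<lambda>x. f x l) (\<Union>(\<B> k)) (A l)"
    if l: "l \<in> ball l0 \<delta>" for l
  proof
    have "l \<in> \<Lambda>" using \<delta>(2) l by blast
    then have "continuous_on UNIV (\<lambda>x. f x l)"
      using assms(2) by (auto simp: is_homeo_def homeomorphism_def)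
    moreover show "A l \<subseteq> \<Union>(\<B> k)"
      using \<delta>(3)[OF l] assms(14)[OF k] by (rule order_trans)
    \<comment> \<open>The new runs use the map at \<open>l\<close> but start from the set computed
      at \<open>l0\<close>; the enclosure just shown links the two.\<close>
    ultimately show "subdivision_approximates (\<lambda>x. f x l) (\<Union>(\<B> k)) (A l)"
      using assms(4)[OF \<open>l \<in> \<Lambda>\<close>] by (intro subdivision_approximates_global_attractor)
  qed
  with \<delta>(1,2) show "\<exists>\<delta>>0. ball l0 \<delta> \<subseteq> \<Lambda> \<and>
      (\<forall>l\<in>ball l0 \<delta>. A l \<subseteq> \<Union>(\<B> k) \<and>
        subdivision_approximates (\<lambda>x. f x l) (\<Union>(\<B> k)) (A l))"
    by blast
qed

end
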